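(* Let $p,q,\upsilon,\gamma_1,\dots,\gamma_6\in\mathbb{C}$ with $\operatorname{Re}(p)>0$, $\operatorname{Re}(q)>0$, $\operatorname{Re}(\upsilon)>0$ and $\gamma_4,\gamma_5,\gamma_6\notin\{0,-1,-2,\dots\}$. Then, for $z,t>0$, $$E_{\gamma_{4},\gamma_{5},\gamma_{6};p;q;\upsilon}^{(\gamma_{1};\gamma_{2};\gamma_{3})}(z,t)=\frac{z^{1-p}t^{1-q}}{(1-D_{t}^{-\upsilon})^{\gamma_{2}}}\;{}_{4}F_{3}\left[\begin{matrix}\frac{\gamma_{1}}{2},\frac{\gamma_{1}+1}{2},\gamma_{2},\gamma_{3}\\ \gamma_{4},\gamma_{5},\gamma_{6}\end{matrix};\frac{-4}{D_{z}(1-D_{t}^{-\upsilon})}\right]\left\{\frac{z^{p-1}t^{q-1}}{\Gamma(p)\Gamma(q)}\right\}.$$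
   Context: $(a)_n$ is the Pochhammer symbol. The modified bivariate I-Konhauser Mittag-Leffler function is $$E_{\gamma_{4},\gamma_{5},\gamma_{6};p;q;\upsilon}^{(\gamma_{1};\gamma_{2};\gamma_{3})}(z,t)=\sum_{l=0}^{\infty}\sum_{n=0}^{\infty}\frac{(-1)^{l}(\gamma_{1})_{2l}(\gamma_{2})_{l+n}(\gamma_{3})_{l}\,z^{l}t^{\upsilon n}}{(\gamma_{4})_{l}(\gamma_{5})_{l}(\gamma_{6})_{l}\,\Gamma(p+l)\,\Gamma(q+\upsilon n)\,n!\,l!}.$$ Operator conventions: $D_t^{-1}f(t)=\int_0^t f(\xi)\,d\xi$ (similarly $D_z^{-1}$), with $D_z^{-l}z^{p-1}=\dfrac{\Gamma(p)z^{p+l-1}}{\Gamma(p+l)}$ and $D_t^{-\upsilon n}t^{q-1}=\dfrac{\Gamma(q)\,t^{q+\upsilon n-1}}{\Gamma(q+\upsilon n)}$. The right-hand side is the formal series of commuting operators $D_z^{-1},D_t^{-\upsilon}$ applied termwise: ${}_4F_3[\alpha_1,\dots,\alpha_4;\beta_1,\beta_2,\beta_3;X]=\sum_{l\ge0}\frac{(\alpha_1)_l(\alpha_2)_l(\alpha_3)_l(\alpha_4)_l}{(\beta_1)_l(\beta_2)_l(\beta_3)_l\,l!}X^l$ with $X^l=(-4)^lD_z^{-l}(1-D_t^{-\upsilon})^{-l}$, and $(1-D_t^{-\upsilon})^{-\gamma}=\sum_{n\ge0}\frac{(\gamma)_n}{n!}D_t^{-\upsilon n}$. *)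

theory Defs
  imports "HOL-Analysis.Analysis" "HOL-Computational_Algebra.Formal_Power_Series"
begin

unbundle fps_syntax

definition I_Konhauser_ML ::
  "complex \<Rightarrow> complex \<Rightarrow> complex \<Rightarrow> complex \<Rightarrow> complex \<Rightarrow> complex \<Rightarrow>
   complex \<Rightarrow> complex \<Rightarrow> complex \<Rightarrow> complex \<Rightarrow> complex \<Rightarrow> complex" where
  "I_Konhauser_ML g1 g2 g3 g4 g5 g6 p q v z t =
     (\<Sum>l. \<Sum>n. (-1) ^ l * pochhammer g1 (2 * l) * pochhammer g2 (l + n) * pochhammer g3 l
                 * z ^ l * t powr (v * of_nat n)
        / (pochhammer g4 l * pochhammer g5 l * pochhammer g6 l
           * Gamma (p + of_nat l) * Gamma (q + v * of_nat n) * fact n * fact l))"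

definition prim :: "(real \<Rightarrow> complex) \<Rightarrow> real \<Rightarrow> complex" where
  "prim f x = integral {0..x} f"

text \<open>
  The integral of complex order \<open>a\<close> with \<open>Re a > 0\<close> is that of Riemann and Liouville. It
  extends the ordinary integral \<open>prim\<close> (see \<open>rl_integral_one\<close>), and it is the operator that
  sends \<open>t powr (b - 1)\<close> to \<open>Gamma b / Gamma (a + b) * t powr (a + b - 1)\<close> if \<open>Re b > 0\<close>.
\<close>

definition rl_integral :: "complex \<Rightarrow> (real \<Rightarrow> complex) \<Rightarrow> real \<Rightarrow> complex" where
  "rl_integral a f x =
     integral {0..x} (\<lambda>\<xi>. complex_of_real (x - \<xi>) powr (a - 1) * f \<xi>) / Gamma a"

lemma rl_integral_one: "rl_integral 1 f x = prim f x"
proof -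
  have "integral {0..x} (\<lambda>\<xi>. complex_of_real (x - \<xi>) powr (1 - 1) * f \<xi>) = integral {0..x} f"
    by (rule integral_spike[of "{x}"]) (auto simp: powr_def)
  then show ?thesis
    by (simp add: rl_integral_def prim_def)
qed

definition Dz_inv :: "(real \<Rightarrow> real \<Rightarrow> complex) \<Rightarrow> real \<Rightarrow> real \<Rightarrow> complex" where
  "Dz_inv f = (\<lambda>z t. prim (\<lambda>\<zeta>. f \<zeta> t) z)"

definition Dt_inv :: "complex \<Rightarrow> (real \<Rightarrow> real \<Rightarrow> complex) \<Rightarrow> real \<Rightarrow> real \<Rightarrow> complex" where
  "Dt_inv v f = (\<lambda>z t. rl_integral v (f z) t)"

text \<open>
  A formal series in the two commuting operators \<open>Dz_inv\<close> and \<open>Dt_inv v\<close> is an element of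
  \<open>complex fps fps\<close>: the outer indeterminate stands for \<open>Dz_inv\<close>, the indeterminate of the
  coefficient ring \<open>complex fps\<close> for \<open>Dt_inv v\<close>. Products of such series are taken in this
  ring, and the result is applied to a function term by term.
\<close>

definition apply_series ::
  "complex fps fps \<Rightarrow> complex \<Rightarrow> (real \<Rightarrow> real \<Rightarrow> complex) \<Rightarrow> real \<Rightarrow> real \<Rightarrow> complex" where
  "apply_series F v f z t = (\<Sum>l. \<Sum>n. F $ l $ n * (Dz_inv ^^ l) ((Dt_inv v ^^ n) f) z t)"

text \<open>The binomial series of \<open>(1 - Y)\<close> to the power \<open>- g\<close>.\<close>

definition one_minus_neg_power :: "complex \<Rightarrow> complex fps" where
  "one_minus_neg_power g = Abs_fps (\<lambda>n. pochhammer g n / fact n)"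

definition lift_coeffs :: "complex fps \<Rightarrow> complex fps fps" where
  "lift_coeffs F = Abs_fps (\<lambda>l. fps_const (F $ l))"

text \<open>
  The series of \<open>(1 - Dt_inv v)\<close> to the power \<open>- g2\<close>, times the generalised hypergeometric
  series at \<open>-4 Dz_inv\<close> times the inverse of \<open>1 - Dt_inv v\<close>.
\<close>

definition hypergeo_series ::
  "complex \<Rightarrow> complex \<Rightarrow> complex \<Rightarrow> complex \<Rightarrow> complex \<Rightarrow> complex \<Rightarrow> complex fps fps" where
  "hypergeo_series g1 g2 g3 g4 g5 g6 =
     fps_const (one_minus_neg_power g2) *
     (lift_coeffs (fps_hypergeo [g1 / 2, (g1 + 1) / 2, g2, g3] [g4, g5, g6] 1)
      oo (fps_const (- 4 * one_minus_neg_power 1) * fps_X))"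

end

theory Submission
  imports Defs
begin

text \<open>
  Each operator in the series acts on a power of \<open>z\<close> or \<open>t\<close> by shifting its exponent. Normalised as
  \<open>x powr (b - 1) / Gamma b\<close>, the powers form a semigroup under integration of complex order
  (\<open>rl_integral_kernel\<close>), so the operator with indices \<open>l\<close> and \<open>n\<close> turns the given function into the
  product of the normalised powers of index \<open>p + l\<close> in \<open>z\<close> and \<open>q + v * n\<close> in \<open>t\<close>. Together with the
  coefficients of the operator series (\<open>hypergeo_series_nth\<close>), every term on the right-hand side is the
  corresponding term of the Mittag-Leffler series times the one constant
  \<open>z powr (p - 1) * t powr (q - 1)\<close>, which the prefactor cancels.

  Two points carry analytic content. The semigroup law for complex orders is the Beta integral with
  complex parameters (\<open>has_integral_Beta_complex\<close>), which is obtained from the Gamma integrals by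
  Fubini's theorem. And the constant can be taken out of the iterated sum only if the inner sums and
  the outer sum converge. For this the growth of \<open>Gamma (q + v * n)\<close> must be estimated for complex \<open>v\<close>;
  successive quotients are Beta values, and the Beta integral bounds these by the Beta function at
  the real parts (\<open>summable_power_div_Gamma\<close>). The inner sums are then bounded by a Pochhammer
  symbol times a geometric factor (\<open>inner_series_bound\<close>), and the outer sum passes the ratio test
  (\<open>summable_outer_majorant\<close>).
\<close>

unbundle no vec_syntax

section \<open>The Beta integral with complex parameters\<close>

lemma Gamma_nonzero_if_Re_pos:
  assumes "Re a > 0"
  shows "Gamma a \<noteq> 0"
proof
  assume "Gamma a = 0"
  then obtain n where "a = - of_nat n"
    by (auto simp: Gamma_eq_zero_iff elim!: nonpos_Ints_cases')
  with assms show False by simp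
qed

text \<open>
  The power is cut off at \<open>0\<close>, so that the Beta integral over \<open>{0..u}\<close> becomes a convolution
  over the whole line and Fubini's theorem needs no bookkeeping of the domain. The exponent \<open>a - 1\<close>
  is that of Euler's integrals.
\<close>
definition pos_powr :: "complex \<Rightarrow> real \<Rightarrow> complex" where
  "pos_powr a t = indicator {0<..} t *\<^sub>R of_real t powr (a - 1)"

lemma pos_powr_measurable [measurable]: "pos_powr a \<in> borel_measurable borel"
  unfolding pos_powr_def
  by (intro borel_measurable_continuous_on_indicator) (auto intro!: continuous_intros)

lemma
  assumes "Re a > 0"
  shows integrable_pos_powr_exp: "integrable lborel (\<lambda>t. pos_powr a t * exp (- of_real t))"
    and integral_pos_powr_exp: "(LINT t|lborel. pos_powr a t * exp (- of_real t)) = Gamma a"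
proof -
  let ?f = "\<lambda>t. complex_of_real t powr (a - 1) / of_real (exp t)"
  have "?f absolutely_integrable_on {0<..}"
    using absolutely_integrable_Gamma_integral'[OF assms] by simp
  moreover have eq: "(\<lambda>t. indicator {0<..} t *\<^sub>R ?f t) = (\<lambda>t. pos_powr a t * exp (- of_real t))"
    by (auto simp: pos_powr_def fun_eq_iff exp_minus exp_of_real field_simps scaleR_conv_of_real)
  ultimately have "integrable lebesgue (\<lambda>t. pos_powr a t * exp (- of_real t))"
    unfolding set_integrable_def by simp
  then show int: "integrable lborel (\<lambda>t. pos_powr a t * exp (- of_real t))"
    by (subst (asm) integrable_completion) auto
  then have "set_integrable lborel {0<..} ?f"
    unfolding set_integrable_def eq .
  then have "(LINT t:{0<..}|lborel. ?f t) = integral {0<..} ?f"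
    by (rule set_borel_integral_eq_integral(2))
  also have "\<dots> = Gamma a"
    using Gamma_integral_complex'[OF assms] by (simp add: integral_unique)
  finally show "(LINT t|lborel. pos_powr a t * exp (- of_real t)) = Gamma a"
    unfolding set_lebesgue_integral_def eq .
qed

lemma pos_powr_scale:
  assumes "u > 0"
  shows "pos_powr a (u * t) * pos_powr b (u - u * t) =
      of_real u powr (a + b - 2) * (pos_powr a t * pos_powr b (1 - t))"
proof (cases "t > 0 \<and> t < 1")
  case t: True
  have "u - u * t = u * (1 - t)" by (simp add: algebra_simps)
  then have "pos_powr a (u * t) * pos_powr b (u - u * t) =
      of_real (u * t) powr (a - 1) * of_real (u * (1 - t)) powr (b - 1)"
    using t assms by (simp add: pos_powr_def)
  also have "\<dots> = (of_real u powr (a - 1) * of_real u powr (b - 1)) *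
      (of_real t powr (a - 1) * of_real (1 - t) powr (b - 1))"
    using t assms unfolding of_real_mult by (subst (1 2) powr_times_real) auto
  also have "of_real u powr (a - 1) * of_real u powr (b - 1) = complex_of_real u powr (a + b - 2)"
    by (simp flip: powr_add)
  finally show ?thesis using t by (simp add: pos_powr_def)
next
  case False
  then have "\<not> (u * t > 0 \<and> u * t < u)"
    using assms by (auto simp: zero_less_mult_iff)
  with False show ?thesis by (auto simp: pos_powr_def)
qed

text \<open>
  Substituting \<open>u * t\<close> for \<open>t\<close> shows that the convolution is homogeneous in \<open>u\<close>. It remains to
  compute the factor, its value at \<open>u = 1\<close>.
\<close>
lemma pos_powr_convolution:
  "(LINT t|lborel. pos_powr a t * pos_powr b (u - t)) =
     pos_powr (a + b) u * (LINT t|lborel. pos_powr a t * pos_powr b (1 - t))"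
proof (cases "u > 0")
  case True
  have "(LINT t|lborel. pos_powr a t * pos_powr b (u - t)) =
      u *\<^sub>R (LINT t|lborel. pos_powr a (u * t) * pos_powr b (u - u * t))"
    using True by (subst lborel_integral_real_affine[where c = u and t = 0]) auto
  also have "\<dots> = (of_real u * of_real u powr (a + b - 2)) *
      (LINT t|lborel. pos_powr a t * pos_powr b (1 - t))"
    by (simp add: pos_powr_scale[OF True] scaleR_conv_of_real)
  also have "of_real u * of_real u powr (a + b - 2) = pos_powr (a + b) u"
  proof -
    have "complex_of_real u powr (1 + (a + b - 2)) = of_real u * of_real u powr (a + b - 2)"
      using True by (subst powr_add) auto
    with True show ?thesis by (simp add: pos_powr_def algebra_simps)
  qed
  finally show ?thesis .
next
  case False
  then have "pos_powr a t * pos_powr b (u - t) = 0" for t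
    by (auto simp: pos_powr_def indicator_def)
  then have "(LINT t|lborel. pos_powr a t * pos_powr b (u - t)) = 0"
    by (simp only: Bochner_Integration.integral_zero)
  with False show ?thesis by (simp add: pos_powr_def)
qed

text \<open>
  Euler's argument: multiply the convolution of the two powers by \<open>exp (- u)\<close> and integrate over \<open>u\<close>.
  By homogeneity this gives \<open>Gamma (a + b)\<close> times the integral in question; in the other order the
  integrals separate into \<open>Gamma a * Gamma b\<close>. The factor \<open>exp (- u)\<close> splits as
  \<open>exp (- t) * exp (- (u - t))\<close>, hence the absolute convergence that Fubini's theorem asks for follows
  from that of the two Gamma integrals.
\<close>
lemma integral_pos_powr_Beta:
  assumes a: "Re a > 0" and b: "Re b > 0"
  shows "(LINT t|lborel. pos_powr a t * pos_powr b (1 - t)) = Beta a b"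
proof -
  have nz: "Gamma (a + b) \<noteq> 0"
    using a b by (intro Gamma_nonzero_if_Re_pos) simp
  let ?g = "\<lambda>a t. pos_powr a t * exp (- of_real t)"
  let ?H = "\<lambda>(t, u). pos_powr a t * pos_powr b (u - t) * exp (- complex_of_real u)"
  have H: "?H (t, u) = ?g a t * ?g b (u - t)" for t u
    by (simp add: exp_diff exp_minus field_simps)
  have shift: "integrable lborel (\<lambda>u. ?g b (u - t))" for t
    using lborel_integrable_real_affine[OF integrable_pos_powr_exp[OF b], of 1 "- t"]
    by (simp add: add.commute)
  have shift_norm: "(LINT u|lborel. norm (?g b (u - t))) = (LINT u|lborel. norm (?g b u))" for t
    using lborel_integral_real_affine[where f = "\<lambda>u. norm (?g b u)" and c = 1 and t = "- t"]
    by simp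
  have shift_int: "(LINT u|lborel. ?g b (u - t)) = Gamma b" for t
    using lborel_integral_real_affine[where f = "\<lambda>u. ?g b u" and c = 1 and t = "- t"]
    by (simp add: integral_pos_powr_exp b)
  have int: "integrable (lborel \<Otimes>\<^sub>M lborel) ?H"
  proof (rule lborel_pair.Fubini_integrable)
    show "?H \<in> borel_measurable (lborel \<Otimes>\<^sub>M lborel)"
      by measurable
    show "integrable lborel (\<lambda>t. LINT u|lborel. norm (?H (t, u)))"
      unfolding H norm_mult[of "?g a _"] using integrable_pos_powr_exp[OF a]
      by (simp only: integral_mult_right_zero shift_norm) (intro integrable_mult_left integrable_norm)
    show "AE t in lborel. integrable lborel (\<lambda>u. ?H (t, u))"
      unfolding H by (intro AE_I2 integrable_mult_right shift)
  qed
  have "(LINT u|lborel. LINT t|lborel. ?H (t, u)) = (LINT t|lborel. LINT u|lborel. ?H (t, u))"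
    using lborel_pair.Fubini_integral[of "\<lambda>t u. ?H (t, u)"] int by simp
  also have "\<dots> = Gamma a * Gamma b"
    unfolding H by (simp only: integral_mult_right_zero integral_mult_left_zero shift_int
        integral_pos_powr_exp[OF a])
  also have "(LINT u|lborel. LINT t|lborel. ?H (t, u)) =
      (LINT u|lborel. ?g (a + b) u) * (LINT t|lborel. pos_powr a t * pos_powr b (1 - t))"
  proof -
    have "(LINT t|lborel. ?H (t, u)) =
        ?g (a + b) u * (LINT t|lborel. pos_powr a t * pos_powr b (1 - t))" for u
      using pos_powr_convolution[of a b u] by simp
    then show ?thesis by (simp only: integral_mult_left_zero)
  qed
  also have "(LINT u|lborel. ?g (a + b) u) = Gamma (a + b)"
    using a b by (intro integral_pos_powr_exp) simp
  finally show ?thesis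
    using nz by (simp add: Beta_def field_simps)
qed

lemma integrable_pos_powr_Beta:
  assumes a: "Re a > 0" and b: "Re b > 0" and u: "u > 0"
  shows "integrable lborel (\<lambda>t. pos_powr a t * pos_powr b (u - t))"
proof -
  have "integrable lborel (\<lambda>t. pos_powr a t * pos_powr b (1 - t))"
  proof (rule Bochner_Integration.integrable_bound)
    show "integrable lborel
        (\<lambda>t. indicator {0..1} t *\<^sub>R (t powr (Re a - 1) * (1 - t) powr (Re b - 1)))"
      using integrable_Beta[OF a b] unfolding set_integrable_def .
    show "(\<lambda>t. pos_powr a t * pos_powr b (1 - t)) \<in> borel_measurable lborel"
      by measurable
  next
    have "norm (of_real t powr (a - 1) * (1 - of_real t) powr (b - 1)) =
        t powr (Re a - 1) * (1 - t) powr (Re b - 1)" if "0 < t" "t < 1" for t :: real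
      using that norm_powr_real_powr[of t "a - 1"] norm_powr_real_powr[of "1 - t" "b - 1"]
      by (simp add: norm_mult)
    then show "AE t in lborel. norm (pos_powr a t * pos_powr b (1 - t)) \<le>
        norm (indicator {0..1} t *\<^sub>R (t powr (Re a - 1) * (1 - t) powr (Re b - 1)))"
      by (intro AE_I2) (auto simp: pos_powr_def indicator_def)
  qed
  then have "integrable lborel (\<lambda>t. pos_powr a (0 + u * t) * pos_powr b (u - (0 + u * t)))"
    by (simp add: pos_powr_scale[OF u])
  then show ?thesis
    using u lborel_integrable_real_affine_iff[of u "\<lambda>t. pos_powr a t * pos_powr b (u - t)" 0]
    by simp
qed

lemma has_integral_Beta_complex:
  assumes a: "Re a > 0" and b: "Re b > 0" and u: "u > 0"
  shows "((\<lambda>t. of_real t powr (a - 1) * of_real (u - t) powr (b - 1)) has_integral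
           of_real u powr (a + b - 1) * Beta a b) {0..u}"
proof -
  let ?f = "\<lambda>t. complex_of_real t powr (a - 1) * of_real (u - t) powr (b - 1)"
  have eq: "(\<lambda>t. indicator {0<..<u} t *\<^sub>R ?f t) = (\<lambda>t. pos_powr a t * pos_powr b (u - t))"
    by (auto simp: pos_powr_def fun_eq_iff indicator_def)
  have int: "set_integrable lborel {0<..<u} ?f"
    unfolding set_integrable_def eq by (rule integrable_pos_powr_Beta[OF assms])
  have "(LINT t:{0<..<u}|lborel. ?f t) = of_real u powr (a + b - 1) * Beta a b"
    unfolding set_lebesgue_integral_def eq
    unfolding pos_powr_convolution[of a b u] integral_pos_powr_Beta[OF a b]
    using u by (simp add: pos_powr_def)
  with set_borel_integral_eq_integral[OF int]
  have "(?f has_integral of_real u powr (a + b - 1) * Beta a b) {0<..<u}"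
    by (simp add: has_integral_iff)
  then show ?thesis
    by (simp only: has_integral_Icc_iff_Ioo)
qed

text \<open>
  The integrand for real parts is the absolute value of the complex integrand. This is the only
  estimate of the complex Gamma function that is needed; it takes the place of Stirling's formula.
\<close>
lemma norm_Beta_le:
  assumes "Re a > 0" "Re b > 0"
  shows "norm (Beta a b) \<le> Beta (Re a) (Re b)"
proof -
  let ?f = "\<lambda>t. complex_of_real t powr (a - 1) * of_real (1 - t) powr (b - 1)"
  let ?g = "\<lambda>t. t powr (Re a - 1) * (1 - t) powr (Re b - 1)"
  have f: "(?f has_integral Beta a b) {0..1}"
    using has_integral_Beta_complex[OF assms, of 1] by simp
  have g: "(?g has_integral Beta (Re a) (Re b)) {0..1}"
    by (rule has_integral_Beta_real[OF assms])
  have "norm (?f t) \<le> ?g t" if "t \<in> {0..1}" for t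
    using that norm_powr_real_powr[of t "a - 1"] norm_powr_real_powr[of "1 - t" "b - 1"]
    by (simp add: norm_mult)
  then have "norm (integral {0..1} ?f) \<le> integral {0..1} ?g"
    using f g by (intro integral_norm_bound_integral) auto
  with f g show ?thesis by (simp add: integral_unique)
qed

text \<open>
  The integrand tends to \<open>0\<close> inside the unit interval and decreases in \<open>n\<close>, so its value at \<open>n = 0\<close>
  is a dominating function.
\<close>
lemma Beta_tendsto_0:
  assumes a: "a > 0" and b: "b > 0" and c: "c > 0"
  shows "(\<lambda>n. Beta a (b + c * real n)) \<longlonglongrightarrow> 0"
proof -
  let ?f = "\<lambda>n t. t powr (b + c * real n - 1) * (1 - t) powr (a - 1)"
  have f: "(?f n has_integral Beta a (b + c * real n)) {0..1}" for n
    using has_integral_Beta_real[of "b + c * real n" a] assms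
    by (simp add: Beta_commute add_pos_nonneg)
  have "(\<lambda>n. integral {0..1} (?f n)) \<longlonglongrightarrow> integral {0..1} (\<lambda>_ :: real. 0 :: real)"
  proof (rule dominated_convergence(2))
    show "?f n integrable_on {0..1}" for n using f by blast
    show "?f 0 integrable_on {0..1}" using f by blast
    show "norm (?f n t) \<le> ?f 0 t" if "t \<in> {0..1}" for n t
      using that c by (auto intro!: mult_right_mono powr_mono')
    show "(\<lambda>n. ?f n t) \<longlonglongrightarrow> 0" if t: "t \<in> {0..1}" for t
    proof (cases "0 < t \<and> t < 1")
      case True
      have "?f n t = t powr (b - 1) * (1 - t) powr (a - 1) * (t powr c) ^ n" for n
        using True powr_add[of t "b - 1" "c * real n"] by (simp add: powr_power algebra_simps)
      moreover have "(\<lambda>n. (t powr c) ^ n) \<longlonglongrightarrow> 0"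
        using True c powr_less_mono2[of c t 1] by (intro LIMSEQ_realpow_zero) auto
      ultimately show ?thesis by (simp only: tendsto_mult_right_zero)
    next
      case False
      with t have "t = 0 \<or> t = 1" by auto
      then show ?thesis by auto
    qed
  qed
  then show ?thesis by (simp add: integral_unique[OF f])
qed

section \<open>Integration operators on normalised powers\<close>

text \<open>
  With the factor \<open>1 / Gamma b\<close> these powers form a semigroup: integration of order \<open>a\<close> shifts the
  index \<open>b\<close> by \<open>a\<close> and produces no further constants.
\<close>
definition rl_kernel :: "complex \<Rightarrow> real \<Rightarrow> complex" where
  "rl_kernel b x = of_real x powr (b - 1) / Gamma b"

text \<open>
  The Beta integral in operator form. Hypothesis and conclusion both speak of all of \<open>{0..}\<close>, the
  point \<open>0\<close> included, so that the lemma can be iterated.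
\<close>
lemma rl_integral_kernel:
  assumes "Re a > 0" "Re b > 0" "x \<ge> 0"
    and f: "\<And>y. y \<ge> 0 \<Longrightarrow> f y = c * rl_kernel b y"
  shows "rl_integral a f x = c * rl_kernel (a + b) x"
proof (cases "x = 0")
  case True
  then show ?thesis by (simp add: rl_integral_def rl_kernel_def)
next
  case False
  with assms have x: "x > 0" by simp
  have nz: "Gamma a \<noteq> 0" "Gamma b \<noteq> 0"
    using assms by (auto dest: Gamma_nonzero_if_Re_pos)
  let ?g = "\<lambda>y. c / Gamma b * (of_real y powr (b - 1) * of_real (x - y) powr (a - 1))"
  have "integral {0..x} (\<lambda>\<xi>. of_real (x - \<xi>) powr (a - 1) * f \<xi>) = integral {0..x} ?g"
    by (intro integral_cong) (simp add: f rl_kernel_def)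
  also have "\<dots> = c / Gamma b * (of_real x powr (b + a - 1) * Beta b a)"
    by (intro integral_unique has_integral_mult_right has_integral_Beta_complex assms x)
  finally show ?thesis
    using nz by (simp add: rl_integral_def rl_kernel_def Beta_def add.commute)
qed

lemma Dt_inv_kernel:
  assumes "Re v > 0" "Re q > 0" "y \<ge> 0"
    and f: "\<And>x y. y \<ge> 0 \<Longrightarrow> f x y = g x * rl_kernel q y"
  shows "(Dt_inv v ^^ n) f x y = g x * rl_kernel (q + v * of_nat n) y"
  using \<open>y \<ge> 0\<close>
proof (induction n arbitrary: x y)
  case 0
  then show ?case by (simp add: f)
next
  case (Suc n)
  have "(Dt_inv v ^^ Suc n) f x y = rl_integral v ((Dt_inv v ^^ n) f x) y"
    by (simp add: Dt_inv_def[of v "(Dt_inv v ^^ n) f"])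
  also have "\<dots> = g x * rl_kernel (v + (q + v * of_nat n)) y"
    using assms Suc by (intro rl_integral_kernel) (simp_all add: add_pos_nonneg)
  finally show ?case by (simp add: algebra_simps)
qed

text \<open>
  The ordinary integral is the integral of order \<open>1\<close>, so the semigroup law applies to it too.
\<close>
lemma Dz_inv_kernel:
  assumes "Re p > 0" "x \<ge> 0"
    and f: "\<And>x. x \<ge> 0 \<Longrightarrow> f x y = c * rl_kernel p x"
  shows "(Dz_inv ^^ l) f x y = c * rl_kernel (p + of_nat l) x"
  using \<open>x \<ge> 0\<close>
proof (induction l arbitrary: x)
  case 0
  then show ?case by (simp add: f)
next
  case (Suc l)
  have "(Dz_inv ^^ Suc l) f x y = rl_integral 1 (\<lambda>\<zeta>. (Dz_inv ^^ l) f \<zeta> y) x"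
    by (simp add: Dz_inv_def rl_integral_one)
  also have "\<dots> = c * rl_kernel (1 + (p + of_nat l)) x"
    using assms Suc by (intro rl_integral_kernel) simp_all
  finally show ?case by (simp add: algebra_simps)
qed

section \<open>Convergence of the double series\<close>

lemma inverse_Gamma_shift:
  assumes "Re v > 0" "Re w > 0"
  shows "inverse (Gamma (w + v)) = Beta v w / Gamma v * inverse (Gamma w)"
  using assms Gamma_nonzero_if_Re_pos[of v] Gamma_nonzero_if_Re_pos[of w]
  by (simp add: Beta_def field_simps)

text \<open>
  The recurrence is stated without division because the terms may vanish from some index on, as they
  do if a numerator parameter is a non-positive integer.
\<close>
lemma summable_ratio_tendsto_0:
  fixes f :: "nat \<Rightarrow> complex"
  assumes step: "\<And>n. f (Suc n) = r n * f n" and r: "r \<longlonglongrightarrow> 0"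
  shows "summable (\<lambda>n. norm (f n))"
proof -
  have "eventually (\<lambda>n. norm (r n) < 1 / 2) sequentially"
    using tendsto_norm_zero[OF r] by (rule order_tendstoD) simp
  then obtain N where N: "\<And>n. n \<ge> N \<Longrightarrow> norm (r n) < 1 / 2"
    by (auto simp: eventually_at_top_linorder)
  show ?thesis
  proof (rule summable_ratio_test)
    show "norm (norm (f (Suc n))) \<le> 1 / 2 * norm (norm (f n))" if "n \<ge> N" for n
      using mult_right_mono[OF less_imp_le[OF N[OF that]], of "norm (f n)"]
      by (simp add: step norm_mult)
  qed simp
qed

lemma ratio_linear_tendsto:
  "(\<lambda>n. (a + c * of_nat n) / (b + of_nat n)) \<longlonglongrightarrow> (c :: complex)"
proof -
  have *: "(\<lambda>n. x / of_nat n) \<longlonglongrightarrow> (0 :: complex)" for x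
    by (rule tendsto_divide_0[OF tendsto_const tendsto_of_nat])
  have "(\<lambda>n. (a / of_nat n + c) / (b / of_nat n + 1)) \<longlonglongrightarrow> (0 + c) / (0 + 1)"
    by (intro tendsto_intros *) simp
  then have "(\<lambda>n. (a / of_nat n + c) / (b / of_nat n + 1)) \<longlonglongrightarrow> c"
    by simp
  moreover have "eventually (\<lambda>n. (a / of_nat n + c) / (b / of_nat n + 1) =
      (a + c * of_nat n) / (b + of_nat n)) sequentially"
    using eventually_gt_at_top[of 0]
  proof eventually_elim
    case (elim n)
    then have "(a / of_nat n + c) = (a + c * of_nat n) / of_nat n"
      "(b / of_nat n + 1) = (b + of_nat n) / of_nat n"
      by (simp_all add: field_simps)
    with elim show ?case by simp
  qed
  ultimately show ?thesis by (rule Lim_transform_eventually)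
qed

text \<open>
  The quotient of successive terms is \<open>X * Beta v w / Gamma v\<close> with \<open>Re w\<close> growing linearly, and this
  Beta value is at most the real one, which tends to \<open>0\<close>. Thus \<open>1 / Gamma (q + v * n)\<close> decays faster
  than any geometric sequence, for complex \<open>v\<close> too.
\<close>
lemma summable_power_div_Gamma:
  assumes v: "Re v > 0" and q: "Re q > 0"
  shows "summable (\<lambda>n. norm (X ^ n / Gamma (q + v * of_nat n)))"
proof (rule summable_ratio_tendsto_0)
  let ?w = "\<lambda>n. q + v * of_nat n"
  have w: "Re (?w n) > 0" for n
    using v q by (simp add: add_pos_nonneg)
  show "X ^ Suc n / Gamma (?w (Suc n)) =
      X * (Beta v (?w n) / Gamma v) * (X ^ n / Gamma (?w n))" for n
    using inverse_Gamma_shift[OF v w[of n]] by (simp add: algebra_simps divide_inverse)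
  have "(\<lambda>n. Beta v (?w n)) \<longlonglongrightarrow> 0"
  proof (rule Lim_null_comparison)
    show "(\<lambda>n. Beta (Re v) (Re q + Re v * real n)) \<longlonglongrightarrow> 0"
      by (rule Beta_tendsto_0[OF v q v])
    show "\<forall>\<^sub>F n in sequentially. norm (Beta v (?w n)) \<le> Beta (Re v) (Re q + Re v * real n)"
      using norm_Beta_le[OF v w] by (simp add: always_eventually)
  qed
  then show "(\<lambda>n. X * (Beta v (?w n) / Gamma v)) \<longlonglongrightarrow> 0"
    by (intro tendsto_mult_right_zero tendsto_divide_zero)
qed

lemma norm_pochhammer_le:
  fixes a :: complex
  assumes "norm a \<le> b"
  shows "norm (pochhammer a n) \<le> pochhammer b n"
proof -
  have "norm (a + of_nat i) \<le> b + of_nat i" for i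
    using norm_triangle_ineq[of a "of_nat i"] assms by simp
  then show ?thesis
    by (auto simp: pochhammer_prod simp flip: prod_norm intro!: prod_mono)
qed

text \<open>
  For a natural parameter the quotient is a binomial coefficient.
\<close>
lemma pochhammer_div_fact_le:
  assumes "N > 0"
  shows "pochhammer (real N) n / fact n \<le> 2 ^ (N + n)"
proof -
  have "pochhammer (real N) n / fact n = real ((N + n - 1) choose n)"
    using assms by (simp add: binomial_gbinomial gbinomial_pochhammer' of_nat_diff)
  also have "\<dots> \<le> 2 ^ (N + n - 1)"
    using of_nat_mono[OF binomial_le_pow2[of "N + n - 1" n], where ?'a = real] by simp
  also have "\<dots> \<le> 2 ^ (N + n)"
    by (intro power_increasing) auto
  finally show ?thesis .
qed

text \<open>
  Separates the two indices of the double series, at the price of a geometric factor.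
\<close>
lemma norm_pochhammer_shift_le:
  fixes a :: complex
  assumes "norm a \<le> real N" "N > 0"
  shows "norm (pochhammer a (l + n) / fact n) \<le> pochhammer (real N) l * 2 ^ (N + l + n)"
proof -
  have "norm (pochhammer a (l + n) / fact n) \<le> pochhammer (real N) (l + n) / fact n"
    using norm_pochhammer_le[OF assms(1), of "l + n"] by (simp add: norm_divide divide_right_mono)
  also have "\<dots> = pochhammer (real N) l * (pochhammer (real (N + l)) n / fact n)"
    by (simp add: pochhammer_product')
  also have "\<dots> \<le> pochhammer (real N) l * 2 ^ (N + l + n)"
    using assms by (intro mult_left_mono pochhammer_div_fact_le pochhammer_nonneg) auto
  finally show ?thesis .
qed

text \<open>
  The symbol \<open>pochhammer a (l + n)\<close> couples the two indices. The separating bound moves the growth in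
  \<open>n\<close> into the base of the power, \<open>2 * X\<close> instead of \<open>X\<close>, where the Gamma function absorbs it. What
  remains is a factor in \<open>l\<close> of the same kind as the other Pochhammer symbols of the outer series.
\<close>
lemma
  fixes a X :: complex
  assumes v: "Re v > 0" and q: "Re q > 0"
  defines "s \<equiv> \<lambda>l n. pochhammer a (l + n) / fact n * (X ^ n / Gamma (q + v * of_nat n))"
  shows summable_inner_series: "summable (s l)"
    and inner_series_bound:
      "\<exists>N C. \<forall>l. norm (\<Sum>n. s l n) \<le> C * (pochhammer (real N) l * 2 ^ l)"
proof -
  define N where "N = Suc (nat \<lceil>norm a\<rceil>)"
  have N: "norm a \<le> real N" "N > 0"
    unfolding N_def using real_nat_ceiling_ge[of "norm a"] by linarith+
  define B where "B n = norm ((2 * X) ^ n / Gamma (q + v * of_nat n))" for n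
  have B: "summable B"
    unfolding B_def by (rule summable_power_div_Gamma[OF v q])
  have le: "norm (s l n) \<le> 2 ^ N * (pochhammer (real N) l * 2 ^ l) * B n" for l n
  proof -
    have "norm (s l n) \<le>
        pochhammer (real N) l * 2 ^ (N + l + n) * norm (X ^ n / Gamma (q + v * of_nat n))"
      unfolding s_def norm_mult[of "_ / _"]
      by (intro mult_right_mono norm_pochhammer_shift_le N norm_ge_zero)
    also have "\<dots> = 2 ^ N * (pochhammer (real N) l * 2 ^ l) * B n"
      by (simp add: B_def power_add norm_mult norm_divide norm_power power_mult_distrib)
    finally show ?thesis .
  qed
  have sB: "summable (\<lambda>n. 2 ^ N * (pochhammer (real N) l * 2 ^ l) * B n)" for l
    by (intro summable_mult B)
  have sn: "summable (\<lambda>n. norm (s l n))" for l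
    using sB by (rule summable_comparison_test'[where N = 0]) (use le in simp)
  then show "summable (s l)" by (rule summable_norm_cancel)
  have "norm (\<Sum>n. s l n) \<le> 2 ^ N * suminf B * (pochhammer (real N) l * 2 ^ l)" for l
  proof -
    have "norm (\<Sum>n. s l n) \<le> (\<Sum>n. norm (s l n))"
      by (rule summable_norm[OF sn])
    also have "\<dots> \<le> (\<Sum>n. 2 ^ N * (pochhammer (real N) l * 2 ^ l) * B n)"
      by (rule suminf_le[OF le sn sB])
    also have "\<dots> = 2 ^ N * (pochhammer (real N) l * 2 ^ l) * suminf B"
      by (rule suminf_mult[OF B])
    finally show ?thesis by (simp add: mult_ac)
  qed
  then show "\<exists>N C. \<forall>l. norm (\<Sum>n. s l n) \<le> C * (pochhammer (real N) l * 2 ^ l)"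
    by blast
qed

definition outer_coeff ::
  "complex \<Rightarrow> complex \<Rightarrow> complex \<Rightarrow> complex \<Rightarrow> complex \<Rightarrow> complex \<Rightarrow> nat \<Rightarrow> complex" where
  "outer_coeff g1 g3 g4 g5 g6 z l =
     (-1) ^ l * pochhammer g1 (2 * l) * pochhammer g3 l * z ^ l
       / (pochhammer g4 l * pochhammer g5 l * pochhammer g6 l * fact l)"

text \<open>
  The numerator has four factors of the size of \<open>fact l\<close>, as \<open>pochhammer g1 (2 * l)\<close> counts twice; the
  denominator has five, \<open>Gamma (p + of_nat l)\<close> and the factorial included. The quotient of successive
  terms therefore decays like \<open>1 / l\<close>.
\<close>
lemma summable_outer_majorant:
  assumes p: "Re p > 0"
  shows "summable (\<lambda>l. norm (outer_coeff g1 g3 g4 g5 g6 z l / Gamma (p + of_nat l)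
           * (pochhammer b l * x ^ l)))"
proof (rule summable_ratio_tendsto_0)
  \<comment> \<open>Each factor is put into the form of \<open>ratio_linear_tendsto\<close>; the last one has numerator slope \<open>0\<close>.\<close>
  let ?r = "\<lambda>l. ((g1 + 2 * of_nat l) / (g4 + of_nat l)) * ((g1 + 1 + 2 * of_nat l) / (g5 + of_nat l))
      * ((g3 + 1 * of_nat l) / (g6 + of_nat l)) * ((b + 1 * of_nat l) / (1 + of_nat l))
      * ((- z * x + 0 * of_nat l) / (p + of_nat l))"
  have "?r \<longlonglongrightarrow> 2 * 2 * 1 * 1 * 0"
    by (intro tendsto_mult ratio_linear_tendsto)
  then show "?r \<longlonglongrightarrow> 0" by simp
  fix l
  have "p + of_nat l \<notin> \<int>\<^sub>\<le>\<^sub>0"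
    using p by (auto elim!: nonpos_Ints_cases' simp: complex_eq_iff)
  then have "Gamma (p + of_nat (Suc l)) = (p + of_nat l) * Gamma (p + of_nat l)"
    using Gamma_plus1[of "p + of_nat l"] by (simp add: add_ac)
  then show "outer_coeff g1 g3 g4 g5 g6 z (Suc l) / Gamma (p + of_nat (Suc l))
           * (pochhammer b (Suc l) * x ^ Suc l) =
      ?r l * (outer_coeff g1 g3 g4 g5 g6 z l / Gamma (p + of_nat l) * (pochhammer b l * x ^ l))"
    by (simp add: outer_coeff_def pochhammer_Suc mult_ac)
qed

text \<open>
  Up to a constant factor, the bound on the inner sums is \<open>pochhammer b l * x ^ l\<close> with \<open>b = N\<close> and
  \<open>x = 2\<close>, which is the form of the majorant.
\<close>
lemma summable_outer_series:
  assumes p: "Re p > 0" and q: "Re q > 0" and v: "Re v > 0"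
  shows "summable (\<lambda>l. outer_coeff g1 g3 g4 g5 g6 z l / Gamma (p + of_nat l) *
    (\<Sum>n. pochhammer a (l + n) / fact n * (X ^ n / Gamma (q + v * of_nat n))))"
    (is "summable (\<lambda>l. ?c l * ?S l)")
proof -
  obtain N C where C: "norm (?S l) \<le> C * (pochhammer (real N) l * 2 ^ l)" for l
    using inner_series_bound[OF v q, of a X] by blast
  show ?thesis
  proof (rule summable_comparison_test'[where N = 0])
    show "summable (\<lambda>l. C * norm (?c l * (pochhammer (of_nat N) l * 2 ^ l)))"
      by (intro summable_mult summable_outer_majorant p)
    fix l
    have "(pochhammer (of_nat N) l :: complex) = of_real (pochhammer (real N) l)"
      using pochhammer_of_real[of "real N" l, where ?'a = complex] by simp
    moreover have "pochhammer (real N) l \<ge> 0"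
      by (simp add: pochhammer_prod prod_nonneg)
    ultimately have "norm (pochhammer (of_nat N) l :: complex) = pochhammer (real N) l"
      by simp
    with mult_left_mono[OF C[of l], of "norm (?c l)"]
    show "norm (?c l * ?S l) \<le> C * norm (?c l * (pochhammer (of_nat N) l * 2 ^ l))"
      by (simp add: norm_mult norm_divide norm_power mult_ac)
  qed
qed

section \<open>Coefficients of the operator series\<close>

lemma one_minus_neg_power_conv_binomial:
  "one_minus_neg_power a = fps_binomial (- a) oo (- fps_X)"
  by (simp add: fps_compose_uminus' one_minus_neg_power_def fps_eq_iff gbinomial_pochhammer
      flip: power_mult_distrib)

lemma one_minus_neg_power_add:
  "one_minus_neg_power (a + b) = one_minus_neg_power a * one_minus_neg_power b"
  using fps_binomial_add_mult[of "- a" "- b"]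
  by (simp add: one_minus_neg_power_conv_binomial fps_compose_mult_distrib)

lemma one_minus_neg_power_1_power: "one_minus_neg_power 1 ^ l = one_minus_neg_power (of_nat l)"
proof (induction l)
  case 0
  show ?case by (auto simp: one_minus_neg_power_def fps_eq_iff pochhammer_0_left)
next
  case (Suc l)
  then show ?case by (simp add: one_minus_neg_power_add)
qed

text \<open>
  The power \<open>l\<close> of the inverse of \<open>1 - Y\<close> joins the prefactor to give the exponent \<open>- (g2 + l)\<close>, whose
  binomial coefficients complete \<open>pochhammer g2 l\<close> to \<open>pochhammer g2 (l + n)\<close>. The duplication formula
  for Pochhammer symbols turns the parameters \<open>g1 / 2\<close>, \<open>(g1 + 1) / 2\<close> and the factor \<open>4 ^ l\<close> into
  \<open>pochhammer g1 (2 * l)\<close>.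
\<close>
lemma hypergeo_series_nth:
  "hypergeo_series g1 g2 g3 g4 g5 g6 $ l $ n =
     (-1) ^ l * pochhammer g1 (2 * l) * pochhammer g3 l * pochhammer g2 (l + n)
       / (pochhammer g4 l * pochhammer g5 l * pochhammer g6 l * fact l * fact n)"
proof -
  let ?c = "fps_hypergeo [g1 / 2, (g1 + 1) / 2, g2, g3] [g4, g5, g6] 1 $ l"
  have c: "?c = pochhammer (g1 / 2) l * pochhammer ((g1 + 1) / 2) l * pochhammer g2 l * pochhammer g3 l
      / (pochhammer g4 l * pochhammer g5 l * pochhammer g6 l * fact l)"
    by (simp add: mult_ac)
  have "hypergeo_series g1 g2 g3 g4 g5 g6 $ l =
      one_minus_neg_power g2 * ((- 4 * one_minus_neg_power 1) ^ l * fps_const ?c)"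
    by (simp add: hypergeo_series_def fps_compose_linear lift_coeffs_def)
  also have "\<dots> = fps_const ((-4) ^ l * ?c) * one_minus_neg_power (g2 + of_nat l)"
  proof -
    have "(- 4 :: complex fps) = fps_const (- 4)"
      by (simp add: numeral_fps_const)
    then show ?thesis
      by (simp only: power_mult_distrib one_minus_neg_power_1_power one_minus_neg_power_add
          fps_const_power fps_const_mult [symmetric] mult_ac)
  qed
  finally have "hypergeo_series g1 g2 g3 g4 g5 g6 $ l $ n =
      (-4) ^ l * ?c * (pochhammer (g2 + of_nat l) n / fact n)"
    by (simp add: one_minus_neg_power_def)
  moreover have "pochhammer g1 (2 * l) = 4 ^ l * pochhammer (g1 / 2) l * pochhammer ((g1 + 1) / 2) l"
    using pochhammer_double[of "g1 / 2" l] by (simp add: add_divide_distrib power_mult)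
  moreover have "(-4 :: complex) ^ l = (-1) ^ l * 4 ^ l"
    by (simp flip: power_mult_distrib)
  ultimately show ?thesis
    unfolding c by (simp add: pochhammer_product' mult_ac)
qed

section \<open>The operational representation\<close>

lemma powr_mult_of_nat: "w powr (v * of_nat n) = (w powr v) ^ n" if "w \<noteq> 0" for v w :: complex
  using that exp_of_nat_mult[of n "v * Ln w"] by (simp add: powr_def mult_ac)

lemma operators_on_powers:
  assumes p: "Re p > 0" and q: "Re q > 0" and v: "Re v > 0" and z: "z > 0" and t: "t > 0"
  shows "(Dz_inv ^^ l) ((Dt_inv v ^^ n)
      (\<lambda>x y. of_real x powr (p - 1) * of_real y powr (q - 1) / (Gamma p * Gamma q))) z t =
    of_real z powr (p - 1) * of_real t powr (q - 1) *
    (of_real z ^ l / Gamma (p + of_nat l) * ((of_real t powr v) ^ n / Gamma (q + v * of_nat n)))"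
    (is "(Dz_inv ^^ l) ((Dt_inv v ^^ n) ?f) z t = _")
proof -
  have "(Dt_inv v ^^ n) ?f x t = rl_kernel p x * rl_kernel (q + v * of_nat n) t" for x
    using q v t by (intro Dt_inv_kernel) (auto simp: rl_kernel_def)
  then have "(Dz_inv ^^ l) ((Dt_inv v ^^ n) ?f) z t =
      rl_kernel (q + v * of_nat n) t * rl_kernel (p + of_nat l) z"
    using p z by (intro Dz_inv_kernel) auto
  moreover have "complex_of_real z powr (p - 1 + of_nat l) = of_real z powr (p - 1) * of_real z ^ l"
    using z by (simp only: powr_add) (simp add: powr_nat')
  moreover have "complex_of_real t powr (q - 1 + v * of_nat n) =
      of_real t powr (q - 1) * (of_real t powr v) ^ n"
    using t by (simp add: powr_add powr_mult_of_nat)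
  ultimately show ?thesis
    by (simp add: rl_kernel_def algebra_simps)
qed

theorem theorem37:
  fixes p q v g1 g2 g3 g4 g5 g6 :: complex and z t :: real
  assumes "Re p > 0" and "Re q > 0" and "Re v > 0"
    and "g4 \<notin> \<int>\<^sub>\<le>\<^sub>0" and "g5 \<notin> \<int>\<^sub>\<le>\<^sub>0" and "g6 \<notin> \<int>\<^sub>\<le>\<^sub>0"
    and "z > 0" and "t > 0"
  shows "I_Konhauser_ML g1 g2 g3 g4 g5 g6 p q v (of_real z) (of_real t) =
    of_real z powr (1 - p) * of_real t powr (1 - q) *
    apply_series (hypergeo_series g1 g2 g3 g4 g5 g6) v
      (\<lambda>x y. of_real x powr (p - 1) * of_real y powr (q - 1) / (Gamma p * Gamma q)) z t"
proof -
  let ?f = "\<lambda>x y. complex_of_real x powr (p - 1) * of_real y powr (q - 1) / (Gamma p * Gamma q)"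
  define X where "X = complex_of_real t powr v"
  define K where "K = complex_of_real z powr (p - 1) * of_real t powr (q - 1)"
  define c where "c l = outer_coeff g1 g3 g4 g5 g6 (of_real z) l / Gamma (p + of_nat l)" for l
  define s where
    "s l n = pochhammer g2 (l + n) / fact n * (X ^ n / Gamma (q + v * of_nat n))" for l n
  have inner: "summable (s l)" for l
    unfolding s_def by (rule summable_inner_series[OF assms(3,2)])
  have outer: "summable (\<lambda>l. c l * (\<Sum>n. s l n))"
    unfolding c_def s_def by (rule summable_outer_series[OF assms(1-3)])

  have lhs: "I_Konhauser_ML g1 g2 g3 g4 g5 g6 p q v (of_real z) (of_real t) =
      (\<Sum>l. \<Sum>n. c l * s l n)"
    using assms(8)
    by (simp add: I_Konhauser_ML_def c_def s_def outer_coeff_def X_def powr_mult_of_nat mult_ac)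
  have term_eq: "hypergeo_series g1 g2 g3 g4 g5 g6 $ l $ n *
      (Dz_inv ^^ l) ((Dt_inv v ^^ n) ?f) z t = K * (c l * s l n)" for l n
    unfolding operators_on_powers[OF assms(1-3,7,8)] hypergeo_series_nth
    by (simp add: K_def c_def s_def outer_coeff_def X_def mult_ac)

  \<comment> \<open>The constant \<open>K\<close> may leave the inner and the outer sum only because both of them converge.\<close>
  have "apply_series (hypergeo_series g1 g2 g3 g4 g5 g6) v ?f z t = (\<Sum>l. \<Sum>n. K * (c l * s l n))"
    by (simp only: apply_series_def term_eq)
  also have "\<dots> = (\<Sum>l. K * (c l * (\<Sum>n. s l n)))"
    by (simp add: suminf_mult summable_mult inner)
  also have "\<dots> = K * (\<Sum>l. c l * (\<Sum>n. s l n))"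
    by (rule suminf_mult[OF outer])
  also have "(\<Sum>l. c l * (\<Sum>n. s l n)) = (\<Sum>l. \<Sum>n. c l * s l n)"
    by (simp add: suminf_mult inner)
  finally have rhs: "apply_series (hypergeo_series g1 g2 g3 g4 g5 g6) v ?f z t =
      K * I_Konhauser_ML g1 g2 g3 g4 g5 g6 p q v (of_real z) (of_real t)"
    by (simp only: lhs)
  have "complex_of_real x powr (1 - a) * of_real x powr (a - 1) = 1" if "x > 0" for x a
    using that by (simp flip: powr_add)
  from this[OF assms(7), of p] this[OF assms(8), of q]
  have "of_real z powr (1 - p) * of_real t powr (1 - q) * K = 1"
    by (simp add: K_def mult.assoc mult.left_commute[of "of_real t powr (1 - q)"])
  then show ?thesis
    by (simp only: rhs mult.assoc[symmetric] mult_1)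
qed

end
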